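(* For every $n\ge4$, $$q(n)\le\begin{cases}2\log_2\!\left(\dfrac{n}{n-2}\right), & n\text{ even},\\[1ex]\log_2\!\left(\dfrac{n+1}{n-3}\right), & n\text{ odd}.\end{cases}$$ In particular, $q(n)=O(1/n)$ as $n\to\infty$.
   Context: For $q>0$, a weak $\mathbb T_q$-representation of the rank-$2$ uniform matroid $U_{2,n}$ is a family of positive reals $(\rho_{ij})_{1\le i<j\le n}$ such that for all $1\le i<j<k<\ell\le n$ the three numbers $(\rho_{ij}\rho_{k\ell})^{1/q}$, $(\rho_{ik}\rho_{j\ell})^{1/q}$, $(\rho_{i\ell}\rho_{jk})^{1/q}$ are the side lengths of a (possibly degenerate) Euclidean triangle (each is at most the sum of the other two). It is identified with the quadratic form $\sum_{i<j}\rho_{ij}x_ix_j$. A quadratic form with nonnegative coefficients in $x_1,\dots,x_n$ is Lorentzian if it is a limit of quadratic forms with nonnegative coefficients whose Hessians have exactly one positive and $n-1$ negative eigenvalues (equivalently, its Hessian has at most one positive eigenvalue). $\mathrm{Gr}^{\mathrm w}_{U_{2,n}}(\mathbb T_q)$ is the set of weak $\mathbb T_q$-representations of $U_{2,n}$ modulo positive scaling, and $\mathbb P\mathrm L_{U_{2,n}}$ is the set of Lorentzian quadratic forms whose set of monomials with nonzero coefficient is exactly $\{x_ix_j:1\le i<j\le n\}$, modulo positive scaling. Define $$q(n):=\sup\{q>0 \mid \mathrm{Gr}^{\mathrm w}_{U_{2,n}}(\mathbb T_q)\subseteq\mathbb P\mathrm L_{U_{2,n}}\}.$$ *)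

theory Defs
  imports
    "HOL-Analysis.Analysis"
    "HOL-Library.Landau_Symbols"
    "Jordan_Normal_Form.Char_Poly"
begin

text \<open>
  The variables are \<open>x\<^sub>0, \<dots>, x\<^sub>n\<^sub>-\<^sub>1\<close> (indices start at 0, as for the type of matrices).
  A quadratic form is given by its coefficients: for \<open>i \<le> j < n\<close>, the number \<open>f i j\<close> is the
  coefficient of the monomial \<open>x\<^sub>i x\<^sub>j\<close>. All other values are 0, so that distinct functions are
  distinct forms.
\<close>

type_synonym quad_form = "nat \<Rightarrow> nat \<Rightarrow> real"

definition quad_forms :: "nat \<Rightarrow> quad_form set" where
  "quad_forms n = {f. \<forall>i j. \<not> (i \<le> j \<and> j < n) \<longrightarrow> f i j = 0}"

definition monomials :: "quad_form \<Rightarrow> (nat \<times> nat) set" where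
  "monomials f = {(i, j). f i j \<noteq> 0}"

definition nonneg_coeffs :: "quad_form \<Rightarrow> bool" where
  "nonneg_coeffs f \<longleftrightarrow> (\<forall>i j. 0 \<le> f i j)"

definition hessian :: "nat \<Rightarrow> quad_form \<Rightarrow> real mat" where
  "hessian n f = mat n n (\<lambda>(i, j). if i = j then 2 * f i i else f (min i j) (max i j))"

text \<open>Eigenvalues with multiplicity; for a real symmetric matrix all \<open>n\<close> of them are real.\<close>

definition eigenvalue_mset :: "real mat \<Rightarrow> real multiset" where
  "eigenvalue_mset A = proots (char_poly A)"

definition strictly_lorentzian :: "nat \<Rightarrow> quad_form \<Rightarrow> bool" where
  "strictly_lorentzian n f \<longleftrightarrow>
     f \<in> quad_forms n \<and> nonneg_coeffs f \<and>
     size {#x \<in># eigenvalue_mset (hessian n f). 0 < x#} = 1 \<and>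
     size {#x \<in># eigenvalue_mset (hessian n f). x < 0#} = n - 1"

text \<open>
  The forms in \<open>n\<close> variables are a finite-dimensional space, so limits are sequential and
  coefficientwise.
\<close>

definition lorentzian :: "nat \<Rightarrow> quad_form \<Rightarrow> bool" where
  "lorentzian n f \<longleftrightarrow>
     f \<in> quad_forms n \<and> nonneg_coeffs f \<and>
     (\<exists>F. (\<forall>k. strictly_lorentzian n (F k)) \<and> (\<forall>i j. (\<lambda>k. F k i j) \<longlonglongrightarrow> f i j))"

definition triangle_sides :: "real \<Rightarrow> real \<Rightarrow> real \<Rightarrow> bool" where
  "triangle_sides a b c \<longleftrightarrow> a \<le> b + c \<and> b \<le> a + c \<and> c \<le> a + b"

text \<open>
  A representation \<open>\<rho>\<close> is identified with the quadratic form \<open>\<Sum>i<j. \<rho> i j x\<^sub>i x\<^sub>j\<close>, hence is 0 off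
  the index set \<open>i < j < n\<close>.
\<close>

definition weak_rep :: "real \<Rightarrow> nat \<Rightarrow> quad_form \<Rightarrow> bool" where
  "weak_rep q n \<rho> \<longleftrightarrow>
     (\<forall>i j. if i < j \<and> j < n then 0 < \<rho> i j else \<rho> i j = 0) \<and>
     (\<forall>i j k l. i < j \<and> j < k \<and> k < l \<and> l < n \<longrightarrow>
        triangle_sides ((\<rho> i j * \<rho> k l) powr (1 / q))
                       ((\<rho> i k * \<rho> j l) powr (1 / q))
                       ((\<rho> i l * \<rho> j k) powr (1 / q)))"

definition pos_scaling :: "(quad_form \<times> quad_form) set" where
  "pos_scaling = {(f, g). \<exists>c>0. g = (\<lambda>i j. c * f i j)}"

definition Gr_weak :: "real \<Rightarrow> nat \<Rightarrow> quad_form set set" where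
  "Gr_weak q n = {\<rho>. weak_rep q n \<rho>} // pos_scaling"

definition PL :: "nat \<Rightarrow> quad_form set set" where
  "PL n = {f. lorentzian n f \<and> monomials f = {(i, j). i < j \<and> j < n}} // pos_scaling"

text \<open>
  The supremum is taken in \<open>[0, \<infinity>]\<close>, so it is meaningful without first knowing that the set is
  nonempty and bounded.
\<close>

definition q_sup :: "nat \<Rightarrow> ennreal" where
  "q_sup n = Sup (ennreal ` {q. 0 < q \<and> Gr_weak q n \<subseteq> PL n})"

end

theory Submission
  imports Defs "HOL-Real_Asymp.Real_Asymp"
begin

text \<open>
  Split the \<open>n\<close> variables into two blocks of sizes \<open>p\<close> and \<open>r = n - p\<close>, and give the monomial
  \<open>x\<^sub>i x\<^sub>j\<close> the coefficient \<open>a\<close> inside a block and \<open>1\<close> across the blocks. The three products of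
  coefficients attached to four indices are all equal, unless two indices lie in each block;
  then they are \<open>a\<^sup>2, 1, 1\<close>. So for \<open>a = 2\<^sup>q\<^sup>/\<^sup>2\<close> the triangles are equilateral or degenerate
  with sides \<open>2, 1, 1\<close>, and the form is a weak representation for the parameter \<open>q\<close>
  (\<open>weak_rep_two_block_form\<close>).

  On the plane of vectors that are constant on each block, the form is
  \<open>(a p (p - 1) s\<^sup>2 + a r (r - 1) t\<^sup>2) / 2 + p r s t\<close>, which is positive definite as soon as
  \<open>a\<^sup>2 (p - 1) (r - 1) > p r\<close>. The Hessian \<open>H\<close> then has two positive eigenvalues, the other
  \<open>n - 2\<close> being \<open>-a\<close>, and the form is not Lorentzian. This is detected by a determinant alone:
  a strictly Lorentzian form has \<open>det (-H) < 0\<close>, hence a Lorentzian one has \<open>det (-H) \<le> 0\<close> by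
  continuity (\<open>lorentzian_det_uminus_nonpos\<close>), whereas here
  \<open>det (-H) = a\<^sup>n\<^sup>-\<^sup>2 (a\<^sup>2 (p - 1) (r - 1) - p r) > 0\<close>
  (\<open>det_uminus_hessian_two_block_form\<close>).

  Since \<open>a\<^sup>2 = 2\<^sup>q\<close>, no \<open>q\<close> above \<open>log\<^sub>2 (p r / ((p - 1) (r - 1)))\<close> is admissible
  (\<open>q_sup_le_two_block\<close>), and the balanced choice \<open>p = \<lfloor>n / 2\<rfloor>\<close> gives both cases of the bound.
\<close>

section \<open>The sign of the Hessian determinant of a Lorentzian form\<close>

lemma poly_eq_prod_proots:
  fixes p :: "'a :: field poly"
  assumes "size (proots p) = degree p"
  shows "p = Polynomial.smult (lead_coeff p) (\<Prod>x\<in>#proots p. [:-x, 1:])"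
  using assms
proof (induction p rule: poly_root_order_induct)
  case 0
  then show ?case by simp
next
  case (no_roots p)
  have "p \<noteq> 0" using no_roots(1)[of 0] by auto
  then have "proots p = {#}"
    using no_roots(1) by (simp add: multiset_eqI order_root)
  with no_roots(2) have "degree p = 0" by simp
  with \<open>proots p = {#}\<close> show ?case
    by (auto elim!: degree_eq_zeroE)
next
  case (root p x n)
  have p0 [simp]: "p \<noteq> 0" using root.hyps by auto
  have roots: "proots ([:-x, 1:] ^ n * p) = replicate_mset n x + proots p"
    by (simp add: proots_mult proots_power multiset_eq_iff)
  have "degree ([:-x, 1:] ^ n * p) = n + degree p"
    by (simp add: degree_mult_eq degree_power_eq)
  with root.prems have "size (proots p) = degree p"
    by (simp add: roots)
  from arg_cong[OF root.IH[OF this], of "(*) ([:-x, 1:] ^ n)"]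
  have IH: "[:-x, 1:] ^ n * p =
      [:-x, 1:] ^ n * Polynomial.smult (lead_coeff p) (\<Prod>x\<in>#proots p. [:-x, 1:])" .
  have lc: "lead_coeff ([:-x, 1:] ^ n * p) = lead_coeff p"
    by (simp add: lead_coeff_mult lead_coeff_power)
  show ?case
    unfolding roots lc by (subst IH) simp
qed

text \<open>
  The determinant of \<open>-H\<close> is the value at 0 of the characteristic polynomial of \<open>H\<close>, that is, the
  product of the negated eigenvalues, of which exactly one is negative and none is 0.
\<close>

lemma strictly_lorentzian_det_uminus_neg:
  assumes "strictly_lorentzian n f" "0 < n"
  shows "Determinant.det (- hessian n f) < 0"
proof -
  define A where "A = hessian n f"
  define M where "M = proots (char_poly A)"
  have A: "A \<in> carrier_mat n n" by (simp add: A_def hessian_def)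
  have deg: "degree (char_poly A) = n" and monic: "lead_coeff (char_poly A) = 1"
    using degree_monic_char_poly[OF A] by auto
  have pos: "size (filter_mset (\<lambda>x. 0 < x) M) = 1"
    and neg: "size (filter_mset (\<lambda>x. x < 0) M) = n - 1"
    using assms(1) by (auto simp: strictly_lorentzian_def eigenvalue_mset_def M_def A_def)
  \<comment> \<open>There is no room left for further roots: \<open>M\<close> has at most \<open>n\<close> elements.\<close>
  have split: "M = filter_mset (\<lambda>x. 0 < x) M + (filter_mset (\<lambda>x. x < 0) M + filter_mset (\<lambda>x. x = 0) M)"
    by (rule multiset_eqI) auto
  have "size M \<le> n"
    using size_proots_le[of "char_poly A"] deg by (simp add: M_def)
  moreover have "size M = 1 + (n - 1 + size (filter_mset (\<lambda>x. x = 0) M))"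
    using arg_cong[OF split, of size] pos neg by simp
  ultimately have zero: "filter_mset (\<lambda>x. x = 0) M = {#}" and size: "size M = n"
    using assms(2) by auto
  obtain c where c: "filter_mset (\<lambda>x. 0 < x) M = {#c#}"
    using size_1_singleton_mset[OF pos] by blast
  then have "c \<in># filter_mset (\<lambda>x. 0 < x) M" by simp
  then have "0 < c" by simp
  have "char_poly A = (\<Prod>x\<in>#M. [:-x, 1:])"
    using poly_eq_prod_proots[of "char_poly A"] size deg monic by (simp add: M_def)
  then have "poly (char_poly A) 0 = (\<Prod>x\<in>#M. - x)"
    by (simp add: poly_prod_mset image_mset.compositionality o_def)
  also have "\<dots> = - c * (\<Prod>x\<in>#filter_mset (\<lambda>x. x < 0) M. - x)"
    by (subst split) (simp add: zero c)
  also have "\<dots> < 0"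
  proof -
    have "0 < (\<Prod>x\<in>#N. - x)" if "\<forall>x\<in>#N. x < 0" for N :: "real multiset"
      using that by (induction N) (auto simp: mult_pos_neg mult_neg_pos)
    then have "0 < (\<Prod>x\<in>#filter_mset (\<lambda>x. x < 0) M. - x)" by simp
    with \<open>0 < c\<close> show ?thesis by (simp add: mult_pos_pos)
  qed
  finally have "poly (char_poly A) 0 < 0" .
  moreover have "poly (char_poly A) 0 = Determinant.det (- A)"
    unfolding char_poly_def
    by (rule poly_det_cong[of _ n]) (use A in \<open>auto simp: char_poly_matrix_def\<close>)
  ultimately show ?thesis by (simp add: A_def)
qed

lemma lorentzian_det_uminus_nonpos:
  assumes "lorentzian n f" "0 < n"
  shows "Determinant.det (- hessian n f) \<le> 0"
proof -
  obtain F where F: "\<And>k. strictly_lorentzian n (F k)" "\<And>i j. (\<lambda>k. F k i j) \<longlonglongrightarrow> f i j"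
    using assms(1) by (auto simp: lorentzian_def)
  have carrier: "- hessian n g \<in> carrier_mat n n" for g by (simp add: hessian_def)
  have entry: "(\<lambda>k. (- hessian n (F k)) $$ (i, j)) \<longlonglongrightarrow> (- hessian n f) $$ (i, j)"
    if "i < n" "j < n" for i j
    using that by (auto simp: hessian_def intro!: tendsto_intros F(2))
  have "(\<lambda>k. Determinant.det (- hessian n (F k))) \<longlonglongrightarrow> Determinant.det (- hessian n f)"
    unfolding det_def'[OF carrier]
    by (intro tendsto_intros entry) (auto simp: permutes_in_image)
  then show ?thesis
    by (rule LIMSEQ_le_const2)
       (use strictly_lorentzian_det_uminus_neg[OF F(1) assms(2)] in \<open>auto intro: less_imp_le\<close>)
qed


section \<open>Forms with two blocks of variables\<close>

text \<open>
  Sylvester's determinant identity, in a division-free form: with \<open>a \<noteq> 0\<close> it reduces the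
  determinant of a scalar matrix perturbed by one of rank at most \<open>m\<close> to size \<open>m\<close>. It is obtained
  by triangularising a bordered matrix in two ways.
\<close>

lemma det_smult_one_minus_mult_commute:
  fixes U V :: "'a :: idom mat"
  assumes U: "U \<in> carrier_mat n m" and V: "V \<in> carrier_mat m n"
  shows "a ^ m * Determinant.det (a \<cdot>\<^sub>m 1\<^sub>m n - U * V) =
         a ^ n * Determinant.det (a \<cdot>\<^sub>m 1\<^sub>m m - V * U)"
proof -
  define M where "M = four_block_mat (a \<cdot>\<^sub>m 1\<^sub>m n) U V (1\<^sub>m m)"
  define L where "L = four_block_mat (1\<^sub>m n) (0\<^sub>m n m) (- V) (1\<^sub>m m)"
  define R where "R = four_block_mat (1\<^sub>m n) (- U) (0\<^sub>m m n) (a \<cdot>\<^sub>m 1\<^sub>m m)"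
  have M: "M \<in> carrier_mat (n + m) (n + m)" and L: "L \<in> carrier_mat (n + m) (n + m)"
    and R: "R \<in> carrier_mat (n + m) (n + m)"
    by (auto simp: M_def L_def R_def)
  have UV: "a \<cdot>\<^sub>m 1\<^sub>m n - U * V \<in> carrier_mat n n"
    and VU: "a \<cdot>\<^sub>m 1\<^sub>m m - V * U \<in> carrier_mat m m"
    by (rule minus_carrier_mat[OF mult_carrier_mat[OF U V]],
        rule minus_carrier_mat[OF mult_carrier_mat[OF V U]])
  have "M * L = four_block_mat (a \<cdot>\<^sub>m 1\<^sub>m n * 1\<^sub>m n + U * (- V)) (a \<cdot>\<^sub>m 1\<^sub>m n * 0\<^sub>m n m + U * 1\<^sub>m m)
      (V * 1\<^sub>m n + 1\<^sub>m m * (- V)) (V * 0\<^sub>m n m + 1\<^sub>m m * 1\<^sub>m m)"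
    unfolding M_def L_def by (rule mult_four_block_mat) (use U V in auto)
  also have "\<dots> = four_block_mat (a \<cdot>\<^sub>m 1\<^sub>m n - U * V) U (0\<^sub>m m n) (1\<^sub>m m)"
    by (rule cong_four_block_mat; rule eq_matI) (use U V in auto)
  finally have lower: "M * L = four_block_mat (a \<cdot>\<^sub>m 1\<^sub>m n - U * V) U (0\<^sub>m m n) (1\<^sub>m m)" .
  have "M * R = four_block_mat (a \<cdot>\<^sub>m 1\<^sub>m n * 1\<^sub>m n + U * 0\<^sub>m m n) (a \<cdot>\<^sub>m 1\<^sub>m n * (- U) + U * (a \<cdot>\<^sub>m 1\<^sub>m m))
      (V * 1\<^sub>m n + 1\<^sub>m m * 0\<^sub>m m n) (V * (- U) + 1\<^sub>m m * (a \<cdot>\<^sub>m 1\<^sub>m m))"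
    unfolding M_def R_def by (rule mult_four_block_mat) (use U V in auto)
  also have "\<dots> = four_block_mat (a \<cdot>\<^sub>m 1\<^sub>m n) (0\<^sub>m n m) V (a \<cdot>\<^sub>m 1\<^sub>m m - V * U)"
    by (rule cong_four_block_mat; rule eq_matI) (use U V in auto)
  finally have upper: "M * R = four_block_mat (a \<cdot>\<^sub>m 1\<^sub>m n) (0\<^sub>m n m) V (a \<cdot>\<^sub>m 1\<^sub>m m - V * U)" .
  have "Determinant.det L = 1"
    unfolding L_def by (subst det_four_block_mat_upper_right_zero[of _ n _ m]) (use V in auto)
  moreover have "Determinant.det (M * L) = Determinant.det (a \<cdot>\<^sub>m 1\<^sub>m n - U * V)"
    unfolding lower
    by (simp add: det_four_block_mat_lower_left_zero[OF UV U refl one_carrier_mat])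
  ultimately have "Determinant.det M = Determinant.det (a \<cdot>\<^sub>m 1\<^sub>m n - U * V)"
    by (simp add: det_mult[OF M L])
  moreover have "Determinant.det R = a ^ m"
    unfolding R_def
    by (subst det_four_block_mat_lower_left_zero[OF one_carrier_mat _ refl smult_carrier_mat[OF one_carrier_mat]])
       (use U in \<open>simp_all add: uminus_carrier_mat\<close>)
  moreover have "Determinant.det (M * R) = a ^ n * Determinant.det (a \<cdot>\<^sub>m 1\<^sub>m m - V * U)"
    unfolding upper
    by (simp add: det_four_block_mat_upper_right_zero[OF smult_carrier_mat[OF one_carrier_mat] refl V VU])
  ultimately show ?thesis
    by (simp add: det_mult[OF M R] mult.commute)
qed

lemma det_mat_2:
  fixes A :: "'a :: idom mat"
  assumes "A \<in> carrier_mat 2 2"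
  shows "Determinant.det A = A $$ (0,0) * A $$ (1,1) - A $$ (0,1) * A $$ (1,0)"
proof -
  \<comment> \<open>The entries are seen as commuting \<open>1 \<times> 1\<close> blocks.\<close>
  define E where "E x = mat 1 1 (\<lambda>_. x)" for x :: 'a
  have E: "E x \<in> carrier_mat 1 1" for x by (simp add: E_def)
  have EE: "E x * E y = E (x * y)" for x y
    by (rule eq_matI) (auto simp: E_def scalar_prod_def)
  have "A = four_block_mat (E (A $$ (0,0))) (E (A $$ (0,1))) (E (A $$ (1,0))) (E (A $$ (1,1)))"
    by (rule eq_matI) (use assms in \<open>auto simp: E_def less_Suc_eq numeral_2_eq_2\<close>)
  also have "Determinant.det \<dots> =
      Determinant.det (E (A $$ (0,0)) * E (A $$ (1,1)) - E (A $$ (0,1)) * E (A $$ (1,0)))"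
    by (rule det_four_block_mat[of _ 1]) (auto simp: E[simplified] EE mult.commute)
  also have "\<dots> = A $$ (0,0) * A $$ (1,1) - A $$ (0,1) * A $$ (1,0)"
    by (subst det_single) (auto simp: EE, auto simp: E_def)
  finally show ?thesis .
qed

text \<open>
  The form whose first \<open>p\<close> variables make up one block and whose other \<open>n - p\<close> variables make up a
  second one: the coefficient of \<open>x\<^sub>i x\<^sub>j\<close> is \<open>a\<close> inside a block and \<open>b\<close> across the blocks.
\<close>

definition two_block_form :: "nat \<Rightarrow> nat \<Rightarrow> real \<Rightarrow> real \<Rightarrow> quad_form" where
  "two_block_form p n a b =
     (\<lambda>i j. if i < j \<and> j < n then if (i < p) = (j < p) then a else b else 0)"

lemma det_uminus_hessian_two_block_form:
  assumes "p \<le> n" and n: "2 \<le> n" and a: "a \<noteq> 0"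
  shows "Determinant.det (- hessian n (two_block_form p n a b)) =
         a ^ (n - 2) * (a\<^sup>2 * ((real p - 1) * (real (n - p) - 1)) - b\<^sup>2 * (real p * real (n - p)))"
proof -
  \<comment> \<open>\<open>-H = a I - U V\<close>, where the columns of \<open>U\<close> are the indicators of the two blocks.\<close>
  define U where "U = mat n 2 (\<lambda>(i, k). if (i < p) = (k = 0) then 1 else 0 :: real)"
  define V where "V = mat 2 n (\<lambda>(k, j). if (j < p) = (k = 0) then a else b)"
  have U: "U \<in> carrier_mat n 2" and V: "V \<in> carrier_mat 2 n"
    by (auto simp: U_def V_def)
  have UV: "(U * V) $$ (i, j) = (if (i < p) = (j < p) then a else b)" if "i < n" "j < n" for i j
  proof -
    have "(U * V) $$ (i, j) = U $$ (i, 0) * V $$ (0, j) + U $$ (i, 1) * V $$ (1, j)"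
      using that U V by (simp add: scalar_prod_def numeral_2_eq_2)
    then show ?thesis using that by (simp add: U_def V_def)
  qed
  have hess: "- hessian n (two_block_form p n a b) = a \<cdot>\<^sub>m 1\<^sub>m n - U * V"
  proof (rule eq_matI)
    fix i j
    assume "i < dim_row (a \<cdot>\<^sub>m 1\<^sub>m n - U * V)" "j < dim_col (a \<cdot>\<^sub>m 1\<^sub>m n - U * V)"
    then have ij: "i < n" "j < n" using U V by auto
    have "(a \<cdot>\<^sub>m 1\<^sub>m n - U * V) $$ (i, j) = (if i = j then a else 0) - (U * V) $$ (i, j)"
      using ij U V by simp
    then show "(- hessian n (two_block_form p n a b)) $$ (i, j) = (a \<cdot>\<^sub>m 1\<^sub>m n - U * V) $$ (i, j)"
      using ij by (cases i j rule: linorder_cases) (simp_all add: UV hessian_def two_block_form_def)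
  qed (use U V in \<open>auto simp: hessian_def\<close>)
  have cards: "card {i. i < n \<and> i < p} = p" "card {i. i < n \<and> \<not> i < p} = n - p"
  proof -
    have "{i. i < n \<and> i < p} = {..<p}" "{i. i < n \<and> \<not> i < p} = {p..<n}"
      using assms(1) by auto
    then show "card {i. i < n \<and> i < p} = p" "card {i. i < n \<and> \<not> i < p} = n - p"
      by simp_all
  qed
  have sum_block: "(\<Sum>i = 0..<n. if i < p then x else y) = real p * x + real (n - p) * y" for x y :: real
    by (simp add: sum.If_cases cards Int_def)
  have VU: "(V * U) $$ (k, l) =
      (if l = 0 then real p * (if k = 0 then a else b) else real (n - p) * (if k = 0 then b else a))"
    if "k < 2" "l < 2" for k l
  proof -
    have "(V * U) $$ (k, l) = (\<Sum>i = 0..<n. V $$ (k, i) * U $$ (i, l))"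
      using that by (simp add: U_def V_def scalar_prod_def)
    also have "\<dots> = (\<Sum>i = 0..<n. if i < p then if l = 0 then if k = 0 then a else b else 0
                                   else if l = 0 then 0 else if k = 0 then b else a)"
      using that by (intro sum.cong) (auto simp: U_def V_def)
    finally show ?thesis by (simp add: sum_block)
  qed
  have "Determinant.det (a \<cdot>\<^sub>m 1\<^sub>m 2 - V * U) =
      (a - real p * a) * (a - real (n - p) * a) - (real (n - p) * b) * (real p * b)"
    by (subst det_mat_2) (use U V in \<open>auto simp: VU simp del: index_mult_mat(1)\<close>)
  also have "\<dots> = a\<^sup>2 * ((real p - 1) * (real (n - p) - 1)) - b\<^sup>2 * (real p * real (n - p))"
    by (simp add: algebra_simps power2_eq_square)
  finally have "a\<^sup>2 * Determinant.det (a \<cdot>\<^sub>m 1\<^sub>m n - U * V) = a ^ n *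
      (a\<^sup>2 * ((real p - 1) * (real (n - p) - 1)) - b\<^sup>2 * (real p * real (n - p)))"
    using det_smult_one_minus_mult_commute[OF U V, of a] by simp
  moreover have "a ^ n = a\<^sup>2 * a ^ (n - 2)"
    using n by (metis le_add_diff_inverse power_add)
  ultimately show ?thesis using a by (simp add: hess)
qed

lemma weak_rep_two_block_form:
  assumes "0 < q"
  shows "weak_rep q n (two_block_form p n (2 powr (q / 2)) 1)"
proof -
  define a where "a = (2 :: real) powr (q / 2)"
  have a: "0 < a" by (simp add: a_def)
  have aa: "(a * a) powr (1 / q) = 2"
    using assms by (simp add: a_def powr_powr flip: powr_add)
  show ?thesis
    unfolding weak_rep_def two_block_form_def triangle_sides_def a_def[symmetric]
    by (auto simp: a aa)
qed

lemma not_lorentzian_two_block_form: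
  assumes p: "2 \<le> p" "p + 2 \<le> n" and a: "0 < a"
    and gt: "b\<^sup>2 * (real p * real (n - p)) < a\<^sup>2 * ((real p - 1) * (real (n - p) - 1))"
  shows "\<not> lorentzian n (two_block_form p n a b)"
proof -
  have "0 < Determinant.det (- hessian n (two_block_form p n a b))"
    by (subst det_uminus_hessian_two_block_form) (use p a gt in \<open>auto intro!: mult_pos_pos\<close>)
  then show ?thesis
    using lorentzian_det_uminus_nonpos[of n "two_block_form p n a b"] p by auto
qed


section \<open>The bound on the supremum\<close>

lemma q_sup_le_two_block:
  assumes p: "2 \<le> p" "p + 2 \<le> n"
  shows "q_sup n \<le> ennreal (log 2 ((real p * real (n - p)) / ((real p - 1) * (real (n - p) - 1))))"
    (is "_ \<le> ennreal (log 2 (?x / ?y))")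
  unfolding q_sup_def
proof (rule Sup_least, clarify)
  fix q :: real
  assume q: "0 < q" and sub: "Gr_weak q n \<subseteq> PL n"
  have y: "0 < ?y" and x: "0 < ?x" using p by (auto intro!: mult_pos_pos)
  have "q \<le> log 2 (?x / ?y)"
  proof (rule ccontr)
    assume "\<not> ?thesis"
    moreover have "0 < ?x / ?y" using x y by (rule divide_pos_pos)
    ultimately have "?x / ?y < 2 powr q"
      using log_less_iff[of 2 "?x / ?y" q] by linarith
    then have gt: "?x < 2 powr q * ?y" using y by (simp only: pos_divide_less_eq)
    define a :: real where "a = 2 powr (q / 2)"
    have a: "0 < a" "a\<^sup>2 = 2 powr q"
      by (simp_all add: a_def power2_eq_square flip: powr_add)
    define \<rho> where "\<rho> = two_block_form p n a 1"
    have "weak_rep q n \<rho>" unfolding \<rho>_def a_def by (rule weak_rep_two_block_form[OF q])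
    then have "pos_scaling `` {\<rho>} \<in> PL n"
      using sub by (auto simp: Gr_weak_def intro!: quotientI)
    then obtain f where f: "lorentzian n f" "pos_scaling `` {\<rho>} = pos_scaling `` {f}"
      by (auto simp: PL_def elim!: quotientE)
    have "(f, f) \<in> pos_scaling" by (auto simp: pos_scaling_def intro!: exI[of _ 1])
    with f(2) have "(\<rho>, f) \<in> pos_scaling" by blast
    then obtain c where c: "0 < c" "f = (\<lambda>i j. c * \<rho> i j)" by (auto simp: pos_scaling_def)
    \<comment> \<open>A Lorentzian representative of the class is again a two-block form.\<close>
    then have "f = two_block_form p n (c * a) c"
      by (auto simp: \<rho>_def two_block_form_def fun_eq_iff)
    moreover have "c\<^sup>2 * ?x < (c * a)\<^sup>2 * ?y"
      using gt c(1) by (simp add: power_mult_distrib a(2) mult.assoc)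
    ultimately show False
      using not_lorentzian_two_block_form[OF p, of "c * a" c] a(1) c(1) f(1) by simp
  qed
  then show "ennreal q \<le> ennreal (log 2 (?x / ?y))" by (rule ennreal_leI)
qed

lemma q_sup_le:
  assumes "4 \<le> n"
  shows "q_sup n \<le> ennreal (if even n then 2 * log 2 (real n / (real n - 2))
                            else log 2 ((real n + 1) / (real n - 3)))"
proof (cases "even n")
  case True
  then obtain m where m: "n = 2 * m" by blast
  have "2 * log 2 (real n / (real n - 2)) = log 2 ((real n / (real n - 2))\<^sup>2)"
    using assms by (simp add: log_nat_power)
  also have "(real n / (real n - 2))\<^sup>2 = (real m * real (n - m)) / ((real m - 1) * (real (n - m) - 1))"
  proof -
    have "real n / (real n - 2) = real m / (real m - 1)"
      using assms by (simp add: m field_simps)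
    then show ?thesis by (simp add: m power2_eq_square)
  qed
  finally show ?thesis
    using q_sup_le_two_block[of m n] assms True m by simp
next
  case False
  then obtain m where m: "n = 2 * m + 1" by (blast elim: oddE)
  have "(real n + 1) / (real n - 3) = (real m * real (n - m)) / ((real m - 1) * (real (n - m) - 1))"
    using assms by (simp add: m field_simps)
  then show ?thesis
    using q_sup_le_two_block[of m n] assms False m by simp
qed

theorem proposition1p4:
  "(\<forall>n::nat. n \<ge> 4 \<longrightarrow>
      q_sup n \<le> ennreal (if even n then 2 * log 2 (real n / (real n - 2))
                         else log 2 ((real n + 1) / (real n - 3)))) \<and>
   (\<lambda>n::nat. enn2real (q_sup n)) \<in> O(\<lambda>n. 1 / real n)"
proof (intro conjI allI impI)
  define B where "B n = (if even n then 2 * log 2 (real n / (real n - 2))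
                         else log 2 ((real n + 1) / (real n - 3)))" for n :: nat
  have "norm (enn2real (q_sup n)) \<le> norm (B n)" if "4 \<le> n" for n
  proof -
    have "0 \<le> B n" using that by (auto simp: B_def)
    moreover have "q_sup n \<le> ennreal (B n)"
      using q_sup_le[OF that] by (simp add: B_def)
    ultimately show ?thesis
      using enn2real_mono[of "q_sup n" "ennreal (B n)"] by simp
  qed
  then have "(\<lambda>n. enn2real (q_sup n)) \<in> O(B)"
    by (intro landau_o.big_mono eventually_mono[OF eventually_ge_at_top[of 4]])
  also have "B \<in> O(\<lambda>n. 1 / real n)"
  proof -
    have "(\<lambda>n::nat. 2 * log 2 (real n / (real n - 2))) \<in> O(\<lambda>n. 1 / real n)"
         "(\<lambda>n::nat. log 2 ((real n + 1) / (real n - 3))) \<in> O(\<lambda>n. 1 / real n)"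
      by real_asymp+
    then have "(\<lambda>n::nat. \<bar>2 * log 2 (real n / (real n - 2))\<bar> +
        \<bar>log 2 ((real n + 1) / (real n - 3))\<bar>) \<in> O(\<lambda>n. 1 / real n)"
      by (intro sum_in_bigo) (simp_all only: landau_o.big.abs_in_iff)
    then show ?thesis
      by (rule landau_o.big_trans[rotated]) (auto simp: B_def intro!: landau_o.big_mono)
  qed
  finally show "(\<lambda>n. enn2real (q_sup n)) \<in> O(\<lambda>n. 1 / real n)" .
qed (rule q_sup_le)

end
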